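(* Let $b=\lambda+i\eta$ with $\lambda>0$ and $\eta\in\mathbb{R}$, and let $\mathcal{X}^{(b)}$ be the set of all the zeros of the complementary Romanovski-Routh polynomials $\mathcal{P}_n(b;x)$ for every $n\ge1$. If $\lambda\ge1$, then $\mathcal{X}^{(b)}$ is dense in $\mathbb{R}$.
   Context: For $b=\lambda+i\eta$ with $\lambda>0$, $\eta\in\mathbb{R}$, the complementary Romanovski-Routh (CRR) polynomials are $\mathcal{P}_n(b;x)=\frac{(2\lambda)_n}{2^n(\lambda)_n}(x-i)^n\,{}_2F_1\!\left(-n,b;b+\overline{b};\frac{-2i}{x-i}\right)$, $n\ge0$, where $(\alpha)_n=\alpha(\alpha+1)\cdots(\alpha+n-1)$. Equivalently, $\mathcal{P}_0(b;x)=1$, $\mathcal{P}_1(b;x)=x-c_1^{(b)}$, and $\mathcal{P}_{n+1}(b;x)=(x-c_{n+1}^{(b)})\mathcal{P}_n(b;x)-d_{n+1}^{(\lambda)}(x^2+1)\mathcal{P}_{n-1}(b;x)$ for $n\ge1$, where $c_n^{(b)}=\frac{\eta}{\lambda+n-1}$ and $d_{n+1}^{(\lambda)}=\frac14\frac{n(n+2\lambda-1)}{(n+\lambda-1)(n+\lambda)}$, $n\ge1$. It is known that $\mathcal{P}_n(b;x)$ has $n$ real simple zeros. *)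

theory Defs
  imports "HOL-Analysis.Analysis"
begin

text \<open>
  The complementary Romanovski-Routh polynomial of degree \<open>n\<close> with parameter
  \<open>b = \<lambda> + i \<eta>\<close>, \<open>\<lambda> > 0\<close>, as a function of the real variable \<open>x\<close> (so that \<open>x - i\<close> never
  vanishes). Its values are real, although this is not visible from the formula. The Gauss series
  terminates because its first parameter is \<open>-n\<close>.
\<close>

definition crr :: "complex \<Rightarrow> nat \<Rightarrow> real \<Rightarrow> complex" where
  "crr b n x =
     of_real (pochhammer (2 * Re b) n / (2 ^ n * pochhammer (Re b) n)) *
     (of_real x - \<i>) ^ n *
     eval_fps (fps_hypergeo [- of_nat n, b] [b + cnj b] 1) (- 2 * \<i> / (of_real x - \<i>))"

text \<open>
  For \<open>\<lambda> > 0\<close> all zeros of these polynomials in the complex plane are real, so nothing is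
  lost by collecting the real ones.
\<close>

definition crr_zeros :: "complex \<Rightarrow> real set" where
  "crr_zeros b = {x. \<exists>n\<ge>1. crr b n x = 0}"

lemma crr_altdef:
  "crr b n x =
     of_real (pochhammer (2 * Re b) n / (2 ^ n * pochhammer (Re b) n)) *
     (\<Sum>k\<le>n. pochhammer (- of_nat n) k * pochhammer b k / (pochhammer (b + cnj b) k * fact k) *
        (- 2 * \<i>) ^ k * (of_real x - \<i>) ^ (n - k))"
proof -
  let ?w = "of_real x - \<i> :: complex"
  have w: "?w \<noteq> 0"
    by (auto simp: complex_eq_iff)
  have pw: "?w ^ n * (C * (- 2 * \<i> / ?w) ^ k) = C * (- 2 * \<i>) ^ k * ?w ^ (n - k)"
    if "k \<le> n" for k and C :: complex
    by (simp only: power_divide power_diff[OF w that])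
      (simp only: ac_simps times_divide_eq_right)
  have "eval_fps (fps_hypergeo [- of_nat n, b] [b + cnj b] 1) (- 2 * \<i> / ?w) =
          (\<Sum>k\<le>n. pochhammer (- of_nat n) k * pochhammer b k / (pochhammer (b + cnj b) k * fact k) *
             (- 2 * \<i> / ?w) ^ k)"
    unfolding eval_fps_def
    by (subst suminf_finite[of "{..n}"]) (auto simp: pochhammer_of_nat_eq_0_iff)
  moreover have "?w ^ n * (\<Sum>k\<le>n. C k * (- 2 * \<i> / ?w) ^ k) =
          (\<Sum>k\<le>n. C k * (- 2 * \<i>) ^ k * ?w ^ (n - k))" for C :: "nat \<Rightarrow> complex"
    unfolding sum_distrib_left by (rule sum.cong[OF refl]) (use pw in auto)
  ultimately show ?thesis
    unfolding crr_def mult.assoc by (simp only: mult.assoc)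
qed

lemma crr_0: "crr b 0 x = 1"
  by (simp add: crr_altdef)

lemma crr_1:
  assumes "Re b > 0"
  shows "crr b 1 x = of_real (x - Im b / Re b)"
  using assms by (simp add: crr_altdef complex_eq_iff Re_divide Im_divide field_simps power2_eq_square)

end

theory Submission
  imports Defs "HOL-Real_Asymp.Real_Asymp"
begin

text \<open>
  After removal of nonzero constant factors, the polynomials satisfy a real three-term
  recurrence in \<open>n\<close>. Dividing the \<open>n\<close>-th one by \<open>(x\<^sup>2 + 1)\<close> to the power \<open>n / 2\<close> turns it into a
  recurrence whose coefficients tend to those of \<open>u (n + 2) = 2 c u (n + 1) - u n\<close> with
  \<open>c = x / sqrt (x\<^sup>2 + 1) = cos \<theta>\<close>. The values at \<open>x\<close> thus oscillate in \<open>n\<close> with an asymptotic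
  frequency \<open>\<theta>\<close> that depends on \<open>x\<close>.

  If an open interval contained no zero at all, then each polynomial would keep its sign there,
  so the sequences of values at two points \<open>x\<close>, \<open>y\<close> of the interval would have the same signs for
  every \<open>n\<close>. Two oscillations with different frequencies cannot do that. The proof passes to
  the limit: rescaled tails of the two sequences have, by compactness, subsequential limits that
  solve the limit recurrences and satisfy \<open>u j * v j \<ge> 0\<close> for all \<open>j\<close>
  (\<open>recurrences_not_same_sign\<close>). For the limit recurrences, the Casorati determinant of \<open>u\<close> and \<open>v\<close>
  is bounded and telescopes to a multiple of the sums of \<open>u j * v j\<close>. So these sums converge,
  \<open>u j * v j\<close> tends to \<open>0\<close>, and the recurrences then force \<open>u j * v (j + 1)\<close> and \<open>u (j + 1) * v j\<close>
  to tend to \<open>0\<close> as well. This contradicts the conservation of a positive definite quadratic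
  form of \<open>(u j, u (j + 1))\<close>, and likewise for \<open>v\<close> (\<open>oscillations_not_same_sign\<close>).
\<close>

section \<open>The three-term recurrence\<close>

text \<open>
  This is the contiguous relation of Gauss in the first parameter. The series is written with
  binomial coefficients, by \<open>(-n)\<^sub>k / k! = (-1)\<^sup>k (n choose k)\<close>, so that comparing coefficients
  needs only Pascal's rule, the absorption identities and \<open>(c + k) B (k + 1) = (b + k) B k\<close> for
  \<open>B k = (b)\<^sub>k / (c)\<^sub>k\<close>.
\<close>

lemma hypergeometric_contiguous:
  fixes b c s :: complex
  assumes c: "\<And>k. c + of_nat k \<noteq> 0"
  defines "F \<equiv> \<lambda>n. \<Sum>k\<le>n. of_nat (n choose k) * (pochhammer b k / pochhammer c k) * (- s) ^ k"
  shows "(c + of_nat (Suc n)) * F (Suc (Suc n)) =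
           (2 * of_nat (Suc n) + c - (b + of_nat (Suc n)) * s) * F (Suc n)
           + of_nat (Suc n) * (s - 1) * F n"
proof -
  define B where "B = (\<lambda>k. pochhammer b k / pochhammer c k)"
  have B_Suc: "(c + of_nat k) * B (Suc k) = (b + of_nat k) * B k" for k
    using c[of k] by (simp add: B_def pochhammer_Suc)
  define p where "p = (\<lambda>n. \<Sum>k\<le>n. monom (of_nat (n choose k) * B k) k)"
  have coeff_p: "coeff (p n) k = of_nat (n choose k) * B k" for n k
    by (auto simp: p_def coeff_sum)
  have F_p: "F n = poly (p n) (- s)" for n
    by (simp add: F_def p_def B_def poly_sum poly_monom)
  let ?N = "of_nat (Suc n) :: complex"
  have "smult (c + ?N) (p (Suc (Suc n))) =
      smult (2 * ?N + c) (p (Suc n)) + pCons 0 (smult (b + ?N) (p (Suc n)))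
      - smult ?N (pCons 0 (p n)) - smult ?N (p n)"
  proof (rule poly_eqI)
    fix k
    show "coeff (smult (c + ?N) (p (Suc (Suc n)))) k =
      coeff (smult (2 * ?N + c) (p (Suc n)) + pCons 0 (smult (b + ?N) (p (Suc n)))
      - smult ?N (pCons 0 (p n)) - smult ?N (p n)) k"
    proof (cases k)
      case 0
      then show ?thesis by (simp add: coeff_p algebra_simps)
    next
      case (Suc j)
      define C1 C2 D1 D2 :: complex
        where "C1 = of_nat (Suc n choose Suc j)" and "C2 = of_nat (Suc n choose j)"
          and "D1 = of_nat (n choose Suc j)" and "D2 = of_nat (n choose j)"
      have pascal: "of_nat (Suc (Suc n) choose Suc j) = C1 + C2"
        by (simp add: C1_def C2_def)
      have a1: "?N * D2 = of_nat (Suc j) * C1"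
        unfolding D2_def C1_def of_nat_mult[symmetric] Suc_times_binomial_eq[of n j]
        by (simp only: mult.commute)
      have C1: "C1 = D1 + D2"
        by (simp add: C1_def D1_def D2_def)
      have a2: "of_nat (Suc j) * C1 = (?N - of_nat j) * C2"
      proof (cases "j \<le> Suc n")
        case True
        then have "(of_nat (Suc j * (Suc n choose Suc j)) :: complex) = of_nat ((Suc n - j) * (Suc n choose j))"
          by (metis binomial_absorb_comp binomial_absorption diff_Suc_1)
        then show ?thesis using True
          by (simp only: of_nat_mult of_nat_diff C1_def C2_def)
      qed (simp add: C1_def C2_def binomial_eq_0)
      have bB: "b * B j = (c + of_nat j) * B (Suc j) - of_nat j * B j"
        using B_Suc[of j] by (simp add: algebra_simps)
      have "(c + ?N) * ((C1 + C2) * B (Suc j)) =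
            (2 * ?N + c) * (C1 * B (Suc j)) + (b + ?N) * (C2 * B j)
            - ?N * (D2 * B j) - ?N * (D1 * B (Suc j))"
        using a1 a2 C1 bB by algebra
      then show ?thesis
        by (simp only: Suc coeff_smult coeff_add coeff_diff coeff_pCons_Suc coeff_p pascal
            C1_def C2_def D1_def D2_def)
    qed
  qed
  from arg_cong[OF this, of "\<lambda>q. poly q (- s)"] show ?thesis
    by (simp add: F_p algebra_simps)
qed

text \<open>
  The terms \<open>(x - \<i>)\<^sup>n F\<^sub>n\<close>, without the constant prefactor of \<open>crr\<close>, where \<open>F\<^sub>n\<close> is the
  hypergeometric factor. In this scaling, Gauss's relation for \<open>F\<^sub>n\<close> becomes visibly real, since
  its coefficients combine through \<open>(x - \<i>) (x + \<i>) = x\<^sup>2 + 1\<close>.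
\<close>

fun crr_scaled :: "real \<Rightarrow> real \<Rightarrow> real \<Rightarrow> nat \<Rightarrow> real" where
  "crr_scaled lam \<eta> x 0 = 1"
| "crr_scaled lam \<eta> x (Suc 0) = x - \<eta> / lam"
| "crr_scaled lam \<eta> x (Suc (Suc n)) =
     (2 * ((real (Suc n) + lam) * x - \<eta>) * crr_scaled lam \<eta> x (Suc n)
      - real (Suc n) * (x\<^sup>2 + 1) * crr_scaled lam \<eta> x n) / (2 * lam + real (Suc n))"

lemma crr_eq_crr_scaled:
  assumes lam: "lam > 0"
  shows "crr (Complex lam \<eta>) n x =
           of_real (pochhammer (2 * lam) n / (2 ^ n * pochhammer lam n) * crr_scaled lam \<eta> x n)"
proof -
  define b where "b = Complex lam \<eta>"
  define w where "w = of_real x - \<i>"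
  define s where "s = - 2 * \<i> / w"
  define c :: complex where "c = of_real (2 * lam)"
  have w0: "w \<noteq> 0" by (auto simp: w_def complex_eq_iff)
  have c0: "c + of_nat k \<noteq> 0" for k
    using lam by (auto simp: c_def complex_eq_iff)
  have bc: "b + cnj b = c" by (simp add: b_def c_def complex_eq_iff)
  define F where
    "F = (\<lambda>n. \<Sum>k\<le>n. of_nat (n choose k) * (pochhammer b k / pochhammer c k) * (- s) ^ k)"
  define G where "G = (\<lambda>n. w ^ n * F n)"
  have crr_G: "crr b n x = of_real (pochhammer (2 * lam) n / (2 ^ n * pochhammer lam n)) * G n" for n
  proof -
    have "pochhammer (- of_nat n) k * pochhammer b k / (pochhammer c k * fact k) *
        (- 2 * \<i>) ^ k * w ^ (n - k)
        = w ^ n * (of_nat (n choose k) * (pochhammer b k / pochhammer c k) * (- s) ^ k)"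
      if k: "k \<le> n" for k
    proof -
      have 1: "pochhammer (- of_nat n :: complex) k = (- 1) ^ k * fact k * of_nat (n choose k)"
        by (simp add: binomial_gbinomial gbinomial_pochhammer)
      have 2: "w ^ (n - k) = w ^ n / w ^ k"
        using k w0 by (simp add: power_diff)
      have 3: "(- s) ^ k = (- 1) ^ k * ((- 2 * \<i>) ^ k / w ^ k)"
        by (simp only: s_def power_minus[of "- 2 * \<i> / w"] power_divide)
      show ?thesis unfolding 1 2 3 by simp
    qed
    then show ?thesis
      unfolding crr_altdef bc G_def F_def sum_distrib_left w_def[symmetric]
      by (simp add: b_def sum_distrib_left)
  qed
  have ws: "w * s = - 2 * \<i>" using w0 by (simp add: s_def)
  have real_ok: "G n = of_real (crr_scaled lam \<eta> x n)" for n
  proof (induction n rule: induct_nat_012)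
    case 0
    then show ?case by (simp add: G_def F_def)
  next
    case 1
    have "G (Suc 0) = w - w * s * b / c"
      by (simp add: G_def F_def algebra_simps)
    also have "\<dots> = of_real (x - \<eta> / lam)"
      using lam unfolding ws
      by (simp add: w_def b_def c_def complex_eq_iff Re_divide Im_divide power2_eq_square)
    finally show ?case by simp
  next
    case (ge2 n)
    let ?N = "of_nat (Suc n) :: complex"
    have "(c + ?N) * G (Suc (Suc n)) = w ^ Suc (Suc n) * ((c + ?N) * F (Suc (Suc n)))"
      by (simp add: G_def)
    also have "(c + ?N) * F (Suc (Suc n)) =
           (2 * ?N + c - (b + ?N) * s) * F (Suc n) + ?N * (s - 1) * F n"
      unfolding F_def by (rule hypergeometric_contiguous[OF c0])
    also have "w ^ Suc (Suc n) * \<dots> =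
        ((2 * ?N + c) * w - (b + ?N) * (w * s)) * G (Suc n) + ?N * (w * (w * s - w)) * G n"
      by (simp add: G_def algebra_simps)
    also have "(2 * ?N + c) * w - (b + ?N) * (w * s) = of_real (2 * ((real (Suc n) + lam) * x - \<eta>))"
      unfolding ws by (simp add: w_def b_def c_def complex_eq_iff algebra_simps)
    also have "w * (w * s - w) = of_real (- (x\<^sup>2 + 1))"
      unfolding ws by (simp add: w_def complex_eq_iff power2_eq_square algebra_simps)
    also have "of_real (2 * ((real (Suc n) + lam) * x - \<eta>)) * G (Suc n)
                 + ?N * of_real (- (x\<^sup>2 + 1)) * G n =
        of_real (2 * ((real (Suc n) + lam) * x - \<eta>) * crr_scaled lam \<eta> x (Suc n)
                 - real (Suc n) * (x\<^sup>2 + 1) * crr_scaled lam \<eta> x n)"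
      unfolding ge2 by (simp del: of_nat_Suc) (simp add: algebra_simps)
    finally have "(c + ?N) * G (Suc (Suc n)) =
        of_real (2 * ((real (Suc n) + lam) * x - \<eta>) * crr_scaled lam \<eta> x (Suc n)
                 - real (Suc n) * (x\<^sup>2 + 1) * crr_scaled lam \<eta> x n)" .
    moreover have "c + ?N = of_real (2 * lam + real (Suc n))" by (simp add: c_def)
    moreover have "c + ?N \<noteq> 0" by (rule c0)
    ultimately show ?case
      unfolding crr_scaled.simps of_real_divide
      by (metis nonzero_mult_div_cancel_left)
  qed
  show ?thesis using crr_G[of n] by (simp add: real_ok b_def)
qed

lemma crr_scaled_eq_0_imp_zero:
  assumes "lam > 0" and "crr_scaled lam \<eta> x n = 0"
  shows "x \<in> crr_zeros (Complex lam \<eta>)"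
proof -
  have "n \<noteq> 0" using assms(2) by (cases n) auto
  moreover have "crr (Complex lam \<eta>) n x = 0"
    using assms by (simp add: crr_eq_crr_scaled)
  ultimately show ?thesis by (auto simp: crr_zeros_def intro!: exI[of _ n])
qed

lemma continuous_on_crr_scaled: "continuous_on A (\<lambda>x. crr_scaled lam \<eta> x n)"
proof (induction n rule: induct_nat_012)
  case 1
  then show ?case by (auto intro!: continuous_intros)
next
  case (ge2 n)
  show ?case unfolding crr_scaled.simps divide_inverse
    by (intro continuous_intros ge2)
qed auto

section \<open>Oscillations with different frequencies\<close>

text \<open>
  The conserved energy of a discrete harmonic oscillator with \<open>\<bar>c\<bar> < 1\<close> is a positive definite form,
  so a nonzero solution neither grows nor decays.
\<close>

lemma oscillation_bounds:
  fixes u :: "nat \<Rightarrow> real"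
  assumes rec: "\<And>j. u (j + 2) = 2 * c * u (j + 1) - u j"
    and c: "\<bar>c\<bar> < 1" and nz: "u 0 \<noteq> 0 \<or> u 1 \<noteq> 0"
  obtains m M where "m > 0" "\<And>j. m \<le> (u j)\<^sup>2 + (u (j + 1))\<^sup>2" "\<And>j. (u j)\<^sup>2 + (u (j + 1))\<^sup>2 \<le> M"
proof -
  define E where "E = (\<lambda>j. (u j)\<^sup>2 + (u (j + 1))\<^sup>2 - 2 * c * (u j * u (j + 1)))"
  define S where "S = (\<lambda>j. (u j)\<^sup>2 + (u (j + 1))\<^sup>2)"
  have E_Suc: "E (Suc j) = E j" for j
  proof -
    have u2: "u (Suc (Suc j)) = 2 * c * u (Suc j) - u j" using rec[of j] by simp
    show ?thesis
      unfolding E_def Suc_eq_plus1[symmetric] u2 by (simp add: power2_eq_square algebra_simps)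
  qed
  have E_const: "E j = E 0" for j by (induction j) (simp_all add: E_Suc)
  have cross: "\<bar>2 * c * (u j * u (j + 1))\<bar> \<le> \<bar>c\<bar> * S j" for j
  proof -
    have "2 * \<bar>u j * u (j + 1)\<bar> \<le> S j"
      using zero_le_power2[of "\<bar>u j\<bar> - \<bar>u (j + 1)\<bar>"]
      by (simp add: S_def power2_eq_square algebra_simps abs_mult)
    then have "\<bar>c\<bar> * (2 * \<bar>u j * u (j + 1)\<bar>) \<le> \<bar>c\<bar> * S j" by (intro mult_left_mono) auto
    then show ?thesis by (simp add: abs_mult mult.assoc)
  qed
  have S0: "S j \<ge> 0" for j by (simp add: S_def)
  have lower: "(1 - \<bar>c\<bar>) * S j \<le> E j" for j
    using cross[of j] unfolding E_def S_def by (simp add: algebra_simps)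
  have upper: "E j \<le> 2 * S j" for j
  proof -
    have "\<bar>c\<bar> * S j \<le> 1 * S j" using c S0 by (intro mult_right_mono) auto
    then show ?thesis using cross[of j] unfolding E_def S_def by simp
  qed
  have "S 0 > 0" using nz by (auto simp: S_def sum_power2_gt_zero_iff)
  then have "0 < (1 - \<bar>c\<bar>) * S 0" using c by simp
  then have "E 0 > 0" using lower[of 0] by simp
  show ?thesis
  proof (rule that)
    show "E 0 / 2 > 0" using \<open>E 0 > 0\<close> by simp
    show "E 0 / 2 \<le> (u j)\<^sup>2 + (u (j + 1))\<^sup>2" for j
      using upper[of j] E_const[of j] by (simp add: S_def)
    show "(u j)\<^sup>2 + (u (j + 1))\<^sup>2 \<le> E 0 / (1 - \<bar>c\<bar>)" for j
      using lower[of j] E_const[of j] c by (simp add: S_def field_simps)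
  qed
qed

text \<open>
  The hypothesis \<open>c\<^sup>2 \<noteq> c'\<^sup>2\<close> excludes, besides equal frequencies, also \<open>c' = - c\<close>, where the linear
  system for the mixed products \<open>u (j + 1) * v j\<close> and \<open>u j * v (j + 1)\<close> becomes singular.
\<close>

lemma oscillations_not_same_sign:
  fixes u v :: "nat \<Rightarrow> real"
  assumes u: "\<And>j. u (j + 2) = 2 * c * u (j + 1) - u j"
    and v: "\<And>j. v (j + 2) = 2 * c' * v (j + 1) - v j"
    and c: "\<bar>c\<bar> < 1" "\<bar>c'\<bar> < 1" "c\<^sup>2 \<noteq> c'\<^sup>2"
    and nz: "u 0 \<noteq> 0 \<or> u 1 \<noteq> 0" "v 0 \<noteq> 0 \<or> v 1 \<noteq> 0"
  shows "\<exists>j. u j * v j < 0"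
proof (rule ccontr)
  assume "\<not> (\<exists>j. u j * v j < 0)"
  then have sign: "u j * v j \<ge> 0" for j by (meson not_le)
  obtain m M where m: "m > 0" "\<And>j. m \<le> (u j)\<^sup>2 + (u (j + 1))\<^sup>2"
      and M: "\<And>j. (u j)\<^sup>2 + (u (j + 1))\<^sup>2 \<le> M"
    using oscillation_bounds[OF u c(1) nz(1)] by blast
  obtain m' M' where m': "m' > 0" "\<And>j. m' \<le> (v j)\<^sup>2 + (v (j + 1))\<^sup>2"
      and M': "\<And>j. (v j)\<^sup>2 + (v (j + 1))\<^sup>2 \<le> M'"
    using oscillation_bounds[OF v c(2) nz(2)] by blast
  define P where "P = (\<lambda>j. u j * v j)"
  define A where "A = (\<lambda>j. u (j + 1) * v j)"
  define B where "B = (\<lambda>j. u j * v (j + 1))"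
  define W where "W = (\<lambda>j. A j - B j)"
  have W_Suc: "W (Suc j) = W j + 2 * (c - c') * P (Suc j)" for j
    by (simp add: W_def A_def B_def P_def u[of j, simplified] v[of j, simplified] algebra_simps)
  have W_sum: "2 * (c - c') * (\<Sum>k\<le>n. P (Suc k)) = W (Suc n) - W 0" for n
    by (induction n) (simp_all add: W_Suc algebra_simps)
  have W_bound: "\<bar>W j\<bar> \<le> M + M'" for j
  proof -
    have amgm: "2 * \<bar>a * b\<bar> \<le> a\<^sup>2 + b\<^sup>2" for a b :: real
      using zero_le_power2[of "\<bar>a\<bar> - \<bar>b\<bar>"] by (simp add: power2_eq_square algebra_simps abs_mult)
    have "2 * \<bar>W j\<bar> \<le> M + M'"
      using amgm[of "u (j + 1)" "v j"] amgm[of "u j" "v (j + 1)"] M[of j] M'[of j]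
        abs_triangle_ineq4[of "A j" "B j"]
      unfolding W_def A_def[symmetric] B_def[symmetric] by (simp add: A_def B_def)
    then show ?thesis by linarith
  qed
  have "summable (\<lambda>k. P (Suc k))"
  proof (rule bounded_imp_summable)
    show "0 \<le> P (Suc k)" for k using sign by (simp add: P_def)
    show "(\<Sum>k\<le>n. P (Suc k)) \<le> (M + M') / \<bar>c - c'\<bar>" for n
    proof -
      have "c \<noteq> c'" using c by auto
      have "2 * (\<bar>c - c'\<bar> * (\<Sum>k\<le>n. P (Suc k))) \<le> \<bar>2 * (c - c') * (\<Sum>k\<le>n. P (Suc k))\<bar>"
        unfolding mult.assoc[of 2] abs_mult[of 2] abs_mult[of "c - c'"]
        by (simp add: mult_left_mono del: right_diff_distrib_numeral)
      also have "\<dots> \<le> 2 * (M + M')"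
        using W_bound[of 0] W_bound[of "Suc n"] abs_triangle_ineq4[of "W (Suc n)" "W 0"]
        unfolding W_sum by simp
      finally show ?thesis using \<open>c \<noteq> c'\<close> by (simp add: field_simps)
    qed
  qed
  then have "(\<lambda>k. P (Suc k)) \<longlonglongrightarrow> 0" by (rule summable_LIMSEQ_zero)
  then have P0: "P \<longlonglongrightarrow> 0" by (simp only: filterlim_sequentially_Suc)
  have P1: "(\<lambda>j. P (j + 1)) \<longlonglongrightarrow> 0" and P2: "(\<lambda>j. P (j + 2)) \<longlonglongrightarrow> 0"
    using LIMSEQ_ignore_initial_segment[OF P0] by blast+
  \<comment> \<open>Expanding \<open>P (j + 2)\<close> gives one linear combination of \<open>A j\<close> and \<open>B j\<close> that tends to \<open>0\<close>;
      one more step of the recurrences exchanges \<open>A\<close> and \<open>B\<close> up to such terms and gives a second.\<close>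
  define X where "X = (\<lambda>j. c * A j + c' * B j)"
  define Y where "Y = (\<lambda>j. c * B j + c' * A j)"
  have "X j = (4 * c * c' * P (j + 1) + P j - P (j + 2)) / 2" for j
    unfolding X_def A_def B_def P_def u v by (simp add: algebra_simps)
  then have "X = (\<lambda>j. (4 * c * c' * P (j + 1) + P j - P (j + 2)) / 2)" by (rule ext)
  moreover have "(\<lambda>j. (4 * c * c' * P (j + 1) + P j - P (j + 2)) / 2) \<longlonglongrightarrow> (4 * c * c' * 0 + 0 - 0) / 2"
    by (intro tendsto_intros P0 P1 P2) simp
  ultimately have X0: "X \<longlonglongrightarrow> 0" by simp
  have X1: "(\<lambda>j. X (j + 1)) \<longlonglongrightarrow> 0" using LIMSEQ_ignore_initial_segment[OF X0] .
  have "Y j = 2 * (c\<^sup>2 + c'\<^sup>2) * P (j + 1) - X (j + 1)" for j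
    unfolding X_def Y_def A_def B_def P_def one_add_one[symmetric] add.assoc[symmetric]
    by (simp add: u[of j, simplified] v[of j, simplified] power2_eq_square algebra_simps)
  then have "Y = (\<lambda>j. 2 * (c\<^sup>2 + c'\<^sup>2) * P (j + 1) - X (j + 1))" by (rule ext)
  moreover have "(\<lambda>j. 2 * (c\<^sup>2 + c'\<^sup>2) * P (j + 1) - X (j + 1)) \<longlonglongrightarrow> 2 * (c\<^sup>2 + c'\<^sup>2) * 0 - 0"
    by (intro tendsto_intros P1 X1)
  ultimately have Y0: "Y \<longlonglongrightarrow> 0" by simp
  have "A j = (c * X j - c' * Y j) / (c\<^sup>2 - c'\<^sup>2)" "B j = (c * Y j - c' * X j) / (c\<^sup>2 - c'\<^sup>2)" for j
    using c(3) by (simp_all add: X_def Y_def field_simps power2_eq_square)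
  then have "A = (\<lambda>j. (c * X j - c' * Y j) / (c\<^sup>2 - c'\<^sup>2))" "B = (\<lambda>j. (c * Y j - c' * X j) / (c\<^sup>2 - c'\<^sup>2))"
    by auto
  moreover have "(\<lambda>j. (c * X j - c' * Y j) / (c\<^sup>2 - c'\<^sup>2)) \<longlonglongrightarrow> (c * 0 - c' * 0) / (c\<^sup>2 - c'\<^sup>2)"
      "(\<lambda>j. (c * Y j - c' * X j) / (c\<^sup>2 - c'\<^sup>2)) \<longlonglongrightarrow> (c * 0 - c' * 0) / (c\<^sup>2 - c'\<^sup>2)"
    using c(3) by - (intro tendsto_intros X0 Y0; simp)+
  ultimately have A0: "A \<longlonglongrightarrow> 0" and B0: "B \<longlonglongrightarrow> 0" by simp_all
  have "(\<lambda>j. (P j)\<^sup>2 + (P (j + 1))\<^sup>2 + (A j)\<^sup>2 + (B j)\<^sup>2) \<longlonglongrightarrow> 0\<^sup>2 + 0\<^sup>2 + 0\<^sup>2 + 0\<^sup>2"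
    by (intro tendsto_intros P0 P1 A0 B0)
  moreover have "m * m' \<le> (P j)\<^sup>2 + (P (j + 1))\<^sup>2 + (A j)\<^sup>2 + (B j)\<^sup>2" for j
  proof -
    have "m * m' \<le> ((u j)\<^sup>2 + (u (j + 1))\<^sup>2) * ((v j)\<^sup>2 + (v (j + 1))\<^sup>2)"
      using m m' by (intro mult_mono) (auto intro: less_imp_le)
    also have "\<dots> = (P j)\<^sup>2 + (P (j + 1))\<^sup>2 + (A j)\<^sup>2 + (B j)\<^sup>2"
      by (simp add: P_def A_def B_def algebra_simps power_mult_distrib)
    finally show ?thesis .
  qed
  ultimately have "m * m' \<le> 0" by (intro LIMSEQ_le_const) auto
  then show False using m(1) m'(1) by (simp add: mult_le_0_iff)
qed

section \<open>Passing to the limit recurrence\<close>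

lemma rescaled_recurrence_limit:
  fixes p :: "nat \<Rightarrow> real"
  assumes rec: "\<And>n. p (n + 2) = a n * p (n + 1) - d n * p n"
    and a: "a \<longlonglongrightarrow> \<alpha>" and d: "d \<longlonglongrightarrow> \<delta>" and r: "strict_mono (r :: nat \<Rightarrow> nat)"
    and init: "convergent (\<lambda>k. s k * p (r k))" "convergent (\<lambda>k. s k * p (r k + 1))"
  obtains u where "\<And>j. (\<lambda>k. s k * p (r k + j)) \<longlonglongrightarrow> u j"
    "\<And>j. u (j + 2) = \<alpha> * u (j + 1) - \<delta> * u j"
proof -
  have shift: "(\<lambda>k. f (r k + j)) \<longlonglongrightarrow> l" if "f \<longlonglongrightarrow> l" for f :: "nat \<Rightarrow> real" and l j
    using LIMSEQ_subseq_LIMSEQ[OF LIMSEQ_ignore_initial_segment[OF that] r] by (simp add: o_def)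
  have step: "(\<lambda>k. s k * p (r k + (j + 2))) \<longlonglongrightarrow> \<alpha> * l' - \<delta> * l"
    if "(\<lambda>k. s k * p (r k + j)) \<longlonglongrightarrow> l" "(\<lambda>k. s k * p (r k + (j + 1))) \<longlonglongrightarrow> l'" for j l l'
  proof -
    have "s k * p (r k + (j + 2)) =
        a (r k + j) * (s k * p (r k + (j + 1))) - d (r k + j) * (s k * p (r k + j))" for k
      unfolding add.assoc[symmetric] rec by (simp add: algebra_simps)
    then show ?thesis
      by (simp only:) (intro tendsto_intros shift a d that)
  qed
  have conv: "convergent (\<lambda>k. s k * p (r k + j))" for j
  proof (induction j rule: induct_nat_012)
    case (ge2 j)
    then show ?case using step[of j] by (auto simp: convergent_def)
  qed (use init in simp_all)
  define u where "u = (\<lambda>j. lim (\<lambda>k. s k * p (r k + j)))"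
  have u: "(\<lambda>k. s k * p (r k + j)) \<longlonglongrightarrow> u j" for j
    using conv[of j] by (simp add: u_def convergent_LIMSEQ_iff)
  show ?thesis
    by (rule that[OF u]) (rule LIMSEQ_unique[OF u step[OF u u]])
qed

text \<open>
  Scaling the pairs of consecutive values to norm \<open>1\<close> keeps the limit solutions from vanishing. The
  scale factors are positive, so the limits inherit the sign condition.
\<close>

lemma recurrences_not_same_sign:
  fixes p q :: "nat \<Rightarrow> real"
  assumes p: "\<And>n. p (n + 2) = a n * p (n + 1) - d n * p n"
    and q: "\<And>n. q (n + 2) = b n * q (n + 1) - e n * q n"
    and a: "a \<longlonglongrightarrow> 2 * c" and d: "d \<longlonglongrightarrow> 1" and b: "b \<longlonglongrightarrow> 2 * c'" and e: "e \<longlonglongrightarrow> 1"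
    and c: "\<bar>c\<bar> < 1" "\<bar>c'\<bar> < 1" "c\<^sup>2 \<noteq> c'\<^sup>2"
  shows "\<exists>n. p n * q n \<le> 0"
proof (rule ccontr)
  assume "\<not> (\<exists>n. p n * q n \<le> 0)"
  then have pos: "p n * q n > 0" for n by (meson not_le)
  then have nz: "p n \<noteq> 0" "q n \<noteq> 0" for n by (metis mult_eq_0_iff less_irrefl)+
  define z where "z = (\<lambda>n. Complex (p n) (p (n + 1)))"
  define w where "w = (\<lambda>n. Complex (q n) (q (n + 1)))"
  have z0: "z n \<noteq> 0" and w0: "w n \<noteq> 0" for n
    using nz[of n] by (auto simp: z_def w_def complex_eq_iff)
  have "seq_compact (sphere 0 1 \<times> sphere 0 1 :: (complex \<times> complex) set)"
    by (intro compact_imp_seq_compact compact_Times compact_sphere)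
  moreover have "\<forall>n. (sgn (z n), sgn (w n)) \<in> sphere 0 1 \<times> sphere 0 1"
    using z0 w0 by (simp add: norm_sgn)
  ultimately obtain l r where l: "l \<in> sphere 0 1 \<times> sphere 0 1" and r: "strict_mono (r :: nat \<Rightarrow> nat)"
      and lim: "((\<lambda>n. (sgn (z n), sgn (w n))) \<circ> r) \<longlonglongrightarrow> l"
    unfolding seq_compact_def by (metis (no_types, lifting))
  define l1 l2 where "l1 = fst l" and "l2 = snd l"
  have l12: "l1 \<noteq> 0" "l2 \<noteq> 0" using l by (auto simp: l1_def l2_def)
  have lim1: "(\<lambda>k. sgn (z (r k))) \<longlonglongrightarrow> l1" and lim2: "(\<lambda>k. sgn (w (r k))) \<longlonglongrightarrow> l2"
    using tendsto_fst[OF lim] tendsto_snd[OF lim] by (simp_all add: o_def l1_def l2_def)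
  define s where "s = (\<lambda>k. 1 / norm (z (r k)))"
  define t where "t = (\<lambda>k. 1 / norm (w (r k)))"
  have sp: "(\<lambda>k. s k * p (r k)) \<longlonglongrightarrow> Re l1" "(\<lambda>k. s k * p (r k + 1)) \<longlonglongrightarrow> Im l1"
    using tendsto_Re[OF lim1] tendsto_Im[OF lim1]
    by (simp_all add: s_def z_def sgn_div_norm divide_inverse mult.commute)
  have tq: "(\<lambda>k. t k * q (r k)) \<longlonglongrightarrow> Re l2" "(\<lambda>k. t k * q (r k + 1)) \<longlonglongrightarrow> Im l2"
    using tendsto_Re[OF lim2] tendsto_Im[OF lim2]
    by (simp_all add: t_def w_def sgn_div_norm divide_inverse mult.commute)
  obtain u where u: "\<And>j. (\<lambda>k. s k * p (r k + j)) \<longlonglongrightarrow> u j"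
      "\<And>j. u (j + 2) = 2 * c * u (j + 1) - 1 * u j"
    using rescaled_recurrence_limit[OF p a d r convergentI[OF sp(1)] convergentI[OF sp(2)]] by blast
  obtain v where v: "\<And>j. (\<lambda>k. t k * q (r k + j)) \<longlonglongrightarrow> v j"
      "\<And>j. v (j + 2) = 2 * c' * v (j + 1) - 1 * v j"
    using rescaled_recurrence_limit[OF q b e r convergentI[OF tq(1)] convergentI[OF tq(2)]] by blast
  have u01: "u 0 = Re l1" "u 1 = Im l1"
    using LIMSEQ_unique[OF u(1)[of 0]] LIMSEQ_unique[OF u(1)[of 1]] sp by simp_all
  have v01: "v 0 = Re l2" "v 1 = Im l2"
    using LIMSEQ_unique[OF v(1)[of 0]] LIMSEQ_unique[OF v(1)[of 1]] tq by simp_all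
  have "u j * v j \<ge> 0" for j
  proof (rule LIMSEQ_le_const[OF tendsto_mult[OF u(1)[of j] v(1)[of j]]])
    have "0 \<le> s k * p (r k + j) * (t k * q (r k + j))" for k
    proof -
      have "0 \<le> (s k * t k) * (p (r k + j) * q (r k + j))"
        using less_imp_le[OF pos[of "r k + j"]] by (intro mult_nonneg_nonneg[of "s k * t k"]) (auto simp: s_def t_def)
      then show ?thesis by (simp only: ac_simps)
    qed
    then show "\<exists>N. \<forall>k\<ge>N. 0 \<le> s k * p (r k + j) * (t k * q (r k + j))" by blast
  qed
  moreover have "\<exists>j. u j * v j < 0"
    using u(2) v(2) c l12 u01 v01
    by (intro oscillations_not_same_sign[of u c v c']) (auto simp: complex_eq_iff)
  ultimately show False by (meson not_le)
qed

section \<open>Density of the zeros\<close>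

text \<open>
  Dividing by \<open>sqrt (x\<^sup>2 + 1) ^ n\<close> makes the coefficient of the older term tend to \<open>1\<close> for every
  \<open>x\<close>, so only \<open>x / sqrt (x\<^sup>2 + 1)\<close> distinguishes the limit recurrences at two points.
\<close>

lemma crr_scaled_normalised_recurrence:
  fixes lam \<eta> x :: real
  assumes lam: "lam > 0"
  defines "\<rho> \<equiv> sqrt (x\<^sup>2 + 1)"
  obtains a d where
    "\<And>n. crr_scaled lam \<eta> x (n + 2) / \<rho> ^ (n + 2) =
        a n * (crr_scaled lam \<eta> x (n + 1) / \<rho> ^ (n + 1)) - d n * (crr_scaled lam \<eta> x n / \<rho> ^ n)"
    "a \<longlonglongrightarrow> 2 * (x / \<rho>)" "d \<longlonglongrightarrow> 1"
proof -
  have \<rho>: "\<rho> > 0" by (auto simp: \<rho>_def add_nonneg_pos)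
  have \<rho>2: "x\<^sup>2 + 1 = \<rho> * \<rho>" by (simp add: \<rho>_def)
  define a where "a = (\<lambda>n. 2 * ((real (Suc n) + lam) * x - \<eta>) / (2 * lam + real (Suc n)) / \<rho>)"
  define d where "d = (\<lambda>n. real (Suc n) / (2 * lam + real (Suc n)))"
  have "(\<lambda>n. 2 * ((real (Suc n) + lam) * x - \<eta>) / (2 * lam + real (Suc n))) \<longlonglongrightarrow> 2 * x"
    using lam by real_asymp
  then have "a \<longlonglongrightarrow> 2 * x / \<rho>"
    unfolding a_def using \<rho> by (intro tendsto_intros) auto
  then have a: "a \<longlonglongrightarrow> 2 * (x / \<rho>)" by simp
  have d: "d \<longlonglongrightarrow> 1" unfolding d_def using lam by real_asymp
  show ?thesis
  proof (rule that[OF _ a d])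
    fix n
    have "2 * lam + real (Suc n) \<noteq> 0" using lam by linarith
    then show "crr_scaled lam \<eta> x (n + 2) / \<rho> ^ (n + 2) =
        a n * (crr_scaled lam \<eta> x (n + 1) / \<rho> ^ (n + 1)) - d n * (crr_scaled lam \<eta> x n / \<rho> ^ n)"
      using \<rho> unfolding a_def d_def \<rho>2 crr_scaled.simps add_2_eq_Suc' Suc_eq_plus1[symmetric]
      by (simp add: divide_simps \<rho>2 del: of_nat_Suc)
  qed
qed

lemma crr_scaled_not_same_sign:
  fixes lam \<eta> x y :: real
  assumes lam: "lam > 0" and xy: "x\<^sup>2 \<noteq> y\<^sup>2"
  shows "\<exists>n. crr_scaled lam \<eta> x n * crr_scaled lam \<eta> y n \<le> 0"
proof -
  let ?\<rho> = "\<lambda>x::real. sqrt (x\<^sup>2 + 1)"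
  have \<rho>: "?\<rho> x > 0" for x :: real by (auto simp: add_nonneg_pos)
  obtain a d where p: "\<And>n. crr_scaled lam \<eta> x (n + 2) / ?\<rho> x ^ (n + 2) =
        a n * (crr_scaled lam \<eta> x (n + 1) / ?\<rho> x ^ (n + 1)) - d n * (crr_scaled lam \<eta> x n / ?\<rho> x ^ n)"
    and a: "a \<longlonglongrightarrow> 2 * (x / ?\<rho> x)" and d: "d \<longlonglongrightarrow> 1"
    using crr_scaled_normalised_recurrence[OF lam, of \<eta> x] by blast
  obtain b e where q: "\<And>n. crr_scaled lam \<eta> y (n + 2) / ?\<rho> y ^ (n + 2) =
        b n * (crr_scaled lam \<eta> y (n + 1) / ?\<rho> y ^ (n + 1)) - e n * (crr_scaled lam \<eta> y n / ?\<rho> y ^ n)"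
    and b: "b \<longlonglongrightarrow> 2 * (y / ?\<rho> y)" and e: "e \<longlonglongrightarrow> 1"
    using crr_scaled_normalised_recurrence[OF lam, of \<eta> y] by blast
  have small: "\<bar>x / ?\<rho> x\<bar> < 1" for x :: real
  proof -
    have "sqrt (x\<^sup>2) < ?\<rho> x" by (rule real_sqrt_less_mono) simp
    then show ?thesis using \<rho>[of x] by (simp add: abs_divide)
  qed
  have sq: "(x / ?\<rho> x)\<^sup>2 = 1 - 1 / (x\<^sup>2 + 1)" for x :: real
  proof -
    have "x\<^sup>2 + 1 \<noteq> 0" by (metis add_nonneg_pos zero_le_power2 zero_less_one less_irrefl)
    then show ?thesis by (simp add: power_divide field_simps)
  qed
  have "(x / ?\<rho> x)\<^sup>2 \<noteq> (y / ?\<rho> y)\<^sup>2"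
    unfolding sq using xy by auto
  from recurrences_not_same_sign[OF p q a d b e small small this]
  obtain n where "crr_scaled lam \<eta> x n / ?\<rho> x ^ n * (crr_scaled lam \<eta> y n / ?\<rho> y ^ n) \<le> 0" by blast
  then have "crr_scaled lam \<eta> x n * crr_scaled lam \<eta> y n / (?\<rho> x ^ n * ?\<rho> y ^ n) \<le> 0"
    by (simp only: times_divide_times_eq)
  moreover have "?\<rho> x ^ n * ?\<rho> y ^ n > 0" using \<rho> by (intro mult_pos_pos zero_less_power)
  ultimately have "crr_scaled lam \<eta> x n * crr_scaled lam \<eta> y n \<le> 0"
    by (simp only: divide_le_0_iff) linarith
  then show ?thesis ..
qed

lemma crr_zero_between:
  fixes lam \<eta> x y :: real
  assumes "lam > 0" "x\<^sup>2 \<noteq> y\<^sup>2" "x < y"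
  shows "\<exists>z\<in>{x..y}. z \<in> crr_zeros (Complex lam \<eta>)"
proof -
  obtain n where n: "crr_scaled lam \<eta> x n * crr_scaled lam \<eta> y n \<le> 0"
    using crr_scaled_not_same_sign[OF assms(1,2)] by blast
  have "\<exists>z. x \<le> z \<and> z \<le> y \<and> crr_scaled lam \<eta> z n = 0"
  proof (cases "crr_scaled lam \<eta> x n \<le> 0")
    case True
    show ?thesis
    proof (cases "crr_scaled lam \<eta> y n \<ge> 0")
      case True
      then show ?thesis
        using \<open>crr_scaled lam \<eta> x n \<le> 0\<close> assms(3)
        by (intro IVT' continuous_on_crr_scaled) auto
    next
      case False
      then have "crr_scaled lam \<eta> x n = 0" using True n by (auto simp: mult_le_0_iff)
      then show ?thesis using assms(3) by auto
    qed
  next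
    case False
    then have "crr_scaled lam \<eta> y n \<le> 0" using n by (auto simp: mult_le_0_iff)
    then show ?thesis
      using False assms(3) by (intro IVT2' continuous_on_crr_scaled) auto
  qed
  then show ?thesis using crr_scaled_eq_0_imp_zero[OF assms(1)] by (meson atLeastAtMost_iff)
qed

theorem theorem3p3:
  fixes lam \<eta> :: real and b :: complex
  assumes "b = Complex lam \<eta>" and "lam > 0" and "lam \<ge> 1"
  shows "closure (crr_zeros b) = UNIV"
proof -
  have "\<exists>z\<in>crr_zeros b. dist z x < \<epsilon>" if "\<epsilon> > 0" for x \<epsilon> :: real
  proof -
    \<comment> \<open>The two points lie on the same side of \<open>0\<close>, so their squares differ.\<close>
    define x1 where "x1 = (if x \<ge> 0 then x else x - \<epsilon> / 2)"
    define x2 where "x2 = x1 + \<epsilon> / 2"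
    have "x1 < x2" "0 \<le> x1 \<or> x2 < 0" "x - \<epsilon> < x1" "x2 < x + \<epsilon>"
      using that by (auto simp: x1_def x2_def)
    then have "x1\<^sup>2 \<noteq> x2\<^sup>2" by (auto simp: power2_eq_iff)
    from crr_zero_between[OF assms(2) this \<open>x1 < x2\<close>, of \<eta>] obtain z
      where "z \<in> crr_zeros b" "x1 \<le> z" "z \<le> x2" unfolding assms(1) by auto
    then show ?thesis
      using \<open>x - \<epsilon> < x1\<close> \<open>x2 < x + \<epsilon>\<close> by (intro bexI[of _ z]) (auto simp: dist_real_def)
  qed
  then show ?thesis by (auto simp: closure_approachable)
qed

end
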